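(* Let $(\Lambda,\eta)$ be an isothermic surface in $S^n$ and $z$ a holomorphic coordinate on $\Sigma$ with $\eta=-\psi\wedge(\psi_{\bar z}\,\mathrm{d}z+\psi_z\,\mathrm{d}\bar z)$. Let $d\in\mathbb{N}_0=\{0,1,2,\dots\}$. Then $(\Lambda,\eta)$ is a special isothermic surface of type $d$ if and only if there exists a formal conserved quantity $p(t)=\sum_{i\le 0}p_it^i$ of $(\Lambda,\eta)$ such that $$2\gamma_{-d,zz}+c\,\gamma_{-d}+2(q_{-d},\kappa)=0,$$ where $\gamma_{-d}$ and $q_{-d}$ are the $\hat\psi$-coefficient and the $V^\perp$-component of $p_{-d}$. In this situation, if $\gamma_{-d}\neq 0$, then $(\Lambda,\eta)$ is a special isothermic surface of type $d$ in $E(p_{-d})$.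
   Context: Everything is smooth. $\mathbb{R}^{n+1,1}$ is the Lorentzian vector space with inner product $(\cdot,\cdot)$ of signature $(n+1,1)$ (extended complex bilinearly), $\mathcal{L}$ is its light-cone (non-zero null vectors), and $S^n$ is identified, as a conformal manifold, with $\mathbb{P}(\mathcal{L})$, whose conformal class consists of the metrics $g_\sigma(X,Y)=(\mathrm{d}\sigma(X),\mathrm{d}\sigma(Y))$ for $\sigma$ never-zero sections of $\mathcal{L}\to\mathbb{P}(\mathcal{L})$. For non-zero $w\in\mathbb{R}^{n+1,1}$, $E(w)=\{v\in\mathcal{L}:(v,w)=-1\}$. $\Sigma$ is a (connected) Riemann surface and $\Lambda:\Sigma\to S^n\cong\mathbb{P}(\mathcal{L})$ is a conformal immersion, viewed as a null line subbundle of $\underline{\mathbb{R}}^{n+1,1}=\Sigma\times\mathbb{R}^{n+1,1}$; $\mathrm{d}$ denotes flat differentiation. Identify $\bigwedge^2\mathbb{R}^{n+1,1}\cong o(\mathbb{R}^{n+1,1})$ via $(u\wedge v)w=(u,w)v-(v,w)u$. An isothermic surface $(\Lambda,\eta)$ is such a $\Lambda$ together with a non-zero closed $1$-form $\eta\in\Omega^1\otimes o(\mathbb{R}^{n+1,1})$ taking values in $\Lambda\wedge\Lambda^\perp$. Frame and invariants: given a holomorphic coordinate $z=u+iv$ on $\Sigma$, $\psi\in\Gamma\Lambda$ is the lift, unique up to sign, with $|\mathrm{d}\psi|^2=|\mathrm{d}z|^2$ (i.e. $(\psi_z,\psi_z)=0$, $(\psi_z,\psi_{\bar z})=\tfrac12$).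 The central sphere congruence is the signature $(3,1)$ subbundle $V\subset\underline{\mathbb{R}}^{n+1,1}$ with $V\otimes\mathbb{C}=\langle\psi,\psi_z,\psi_{\bar z},\psi_{z\bar z}\rangle$. $\hat\psi\in\Gamma(V)$ is the unique section with $(\hat\psi,\hat\psi)=0$, $(\hat\psi,\psi)=-1$, $(\hat\psi,\mathrm{d}\psi)=0$, so $\psi,\psi_z,\psi_{\bar z},\hat\psi$ frame $V\otimes\mathbb{C}$. The Schwarzian derivative $c$ (a complex function) and Hopf differential $\kappa\in\Gamma(V^\perp\otimes\mathbb{C})$ are defined by $\psi_{zz}+\frac c2\psi=\kappa$. When $\eta=-\psi\wedge(\psi_{\bar z}\mathrm{d}z+\psi_z\mathrm{d}\bar z)$, $\kappa$ is real. A formal conserved quantity of $(\Lambda,\eta)$ is a formal Laurent series $p(t)=\sum_{i\le 0}p_it^i$ with $p_i\in\Gamma(\underline{\mathbb{R}}^{n+1,1})$, $p_0\neq 0$, such that $(\mathrm{d}+t\eta)p(t)$ is the zero series. Write $p_i=\alpha_i\psi+\beta_i\psi_z+\overline{\beta_i}\psi_{\bar z}+\gamma_i\hat\psi+q_i$ with $\alpha_i,\gamma_i$ real functions, $\beta_i$ a complex function, $q_i\in\Gamma(V^\perp)$. Here $\gamma_{-d}\ne0$ means $\gamma_{-d}$ is not identically zero; in the situation of the theorem $p_{-d}$ is constant. A polynomial conserved quantity of $(\Lambda,\eta)$ is a polynomial $P(t)=\sum_{i=0}^dP_it^i\in\Gamma(\underline{\mathbb{R}}^{n+1,1})[t]$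 such that $(\mathrm{d}+t\eta)P(t)\equiv 0$. $(\Lambda,\eta)$ is special isothermic of type $d$ if it admits a polynomial conserved quantity of degree $d$, and special isothermic of type $d$ in $E(w)$ if it admits one of degree $d$ with constant term $P_0\in\langle w\rangle$. *)

theory Defs
  imports "HOL-Analysis.Analysis"
begin

section \<open>The Lorentzian vector space\<close>

text \<open>
  \<open>'k^'m option\<close> with \<open>CARD('m) = n + 1\<close> is \<open>\<real>\<^sup>n\<^sup>+\<^sup>1\<^sup>,\<^sup>1\<close> for real scalars and its complexification for
  complex scalars. The index \<open>None\<close> is the timelike direction.
\<close>

definition lor :: "'k::comm_ring_1 ^ ('m::finite option) \<Rightarrow> 'k ^ ('m option) \<Rightarrow> 'k" where
  "lor x y = (\<Sum>i\<in>UNIV. x $ Some i * y $ Some i) - x $ None * y $ None"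

definition wedge ::
    "'k::comm_ring_1 ^ ('m::finite option) \<Rightarrow> 'k ^ ('m option) \<Rightarrow> 'k ^ ('m option) ^ ('m option)" where
  "wedge u v = matrix (\<lambda>w. lor u w *s v - lor v w *s u)"

definition orth :: "(real ^ ('m::finite option)) set \<Rightarrow> (real ^ ('m option)) set" where
  "orth U = {v. \<forall>u\<in>U. lor v u = 0}"

definition cvec :: "real ^ 'i::finite \<Rightarrow> complex ^ 'i" where
  "cvec v = (\<chi> i. of_real (v $ i))"

definition complexification :: "(real ^ 'i::finite) set \<Rightarrow> (complex ^ 'i) set" where
  "complexification U = {cvec a + \<i> *s cvec b | a b. a \<in> U \<and> b \<in> U}"

section \<open>Calculus on a Riemann surface in a holomorphic coordinate\<close>

text \<open>
  A Riemann surface with a holomorphic coordinate defined on all of it is a connected space \<open>S\<close>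
  with a homeomorphism \<open>z\<close> onto an open subset of the complex plane; its complex structure is the
  one making \<open>z\<close> biholomorphic. The coordinate trivialises the tangent bundle, and a tangent
  vector \<open>X\<close> is written as the complex number \<open>dz(X)\<close>. Maps, sections and forms are total
  functions of which only the values on \<open>S\<close> matter.
\<close>

definition riemann_surface_coordinate ::
    "'a::topological_space set \<Rightarrow> ('a \<Rightarrow> complex) \<Rightarrow> bool" where
  "riemann_surface_coordinate S z \<longleftrightarrow>
     S \<noteq> {} \<and> connected S \<and> (\<exists>T y. open T \<and> homeomorphism S T z y)"

fun Ck :: "nat \<Rightarrow> complex set \<Rightarrow> (complex \<Rightarrow> 'b::real_normed_vector) \<Rightarrow> bool" where
  "Ck 0 T g \<longleftrightarrow> continuous_on T g"
| "Ck (Suc k) T g \<longleftrightarrow>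
     (\<forall>w\<in>T. g differentiable (at w)) \<and> (\<forall>X. Ck k T (\<lambda>w. frechet_derivative g (at w) X))"

definition smooth :: "'a set \<Rightarrow> ('a \<Rightarrow> complex) \<Rightarrow> 'a set \<Rightarrow> ('a \<Rightarrow> 'b::real_normed_vector) \<Rightarrow> bool" where
  "smooth S z W f \<longleftrightarrow> (\<forall>k. Ck k (z ` W) (f \<circ> inv_into S z))"

text \<open>\<open>diff S z f x X\<close> is \<open>df(X)\<close> at the point \<open>x\<close>.\<close>

definition diff :: "'a set \<Rightarrow> ('a \<Rightarrow> complex) \<Rightarrow> ('a \<Rightarrow> 'b::real_normed_vector) \<Rightarrow> 'a \<Rightarrow> complex \<Rightarrow> 'b" where
  "diff S z f x X = frechet_derivative (f \<circ> inv_into S z) (at (z x)) X"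

definition d_z :: "'a set \<Rightarrow> ('a \<Rightarrow> complex) \<Rightarrow> ('a \<Rightarrow> complex) \<Rightarrow> 'a \<Rightarrow> complex" where
  "d_z S z f x = (1/2) * (diff S z f x 1 - \<i> * diff S z f x \<i>)"

definition dv_z :: "'a set \<Rightarrow> ('a \<Rightarrow> complex) \<Rightarrow> ('a \<Rightarrow> complex ^ 'i::finite) \<Rightarrow> 'a \<Rightarrow> complex ^ 'i" where
  "dv_z S z f x = (1/2) *s (diff S z f x 1 - \<i> *s diff S z f x \<i>)"

definition dv_zbar :: "'a set \<Rightarrow> ('a \<Rightarrow> complex) \<Rightarrow> ('a \<Rightarrow> complex ^ 'i::finite) \<Rightarrow> 'a \<Rightarrow> complex ^ 'i" where
  "dv_zbar S z f x = (1/2) *s (diff S z f x 1 + \<i> *s diff S z f x \<i>)"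

section \<open>Isothermic surfaces\<close>

text \<open>
  A map into the conformal sphere is given by its null lines \<open>\<Lambda> x\<close>. Never-zero sections over an
  open set \<open>W\<close> are the compositions with \<open>\<Lambda>\<close> of sections of the light-cone, so they induce the
  metrics of the conformal class.
\<close>

definition lift_on :: "'a::topological_space set \<Rightarrow> ('a \<Rightarrow> complex) \<Rightarrow>
    ('a \<Rightarrow> (real ^ ('m::finite option)) set) \<Rightarrow> 'a set \<Rightarrow> ('a \<Rightarrow> real ^ ('m option)) \<Rightarrow> bool" where
  "lift_on S z \<Lambda> W \<sigma> \<longleftrightarrow>
     openin (top_of_set S) W \<and> smooth S z W \<sigma> \<and> (\<forall>x\<in>W. \<sigma> x \<in> \<Lambda> x \<and> \<sigma> x \<noteq> 0)"

definition null_line_bundle :: "'a::topological_space set \<Rightarrow> ('a \<Rightarrow> complex) \<Rightarrow>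
    ('a \<Rightarrow> (real ^ ('m::finite option)) set) \<Rightarrow> bool" where
  "null_line_bundle S z \<Lambda> \<longleftrightarrow>
     (\<forall>x\<in>S. \<exists>v. v \<noteq> 0 \<and> lor v v = 0 \<and> \<Lambda> x = span {v}) \<and>
     (\<forall>x\<in>S. \<exists>W \<sigma>. x \<in> W \<and> lift_on S z \<Lambda> W \<sigma>)"

definition conformal_immersion :: "'a::topological_space set \<Rightarrow> ('a \<Rightarrow> complex) \<Rightarrow>
    ('a \<Rightarrow> (real ^ ('m::finite option)) set) \<Rightarrow> bool" where
  "conformal_immersion S z \<Lambda> \<longleftrightarrow> null_line_bundle S z \<Lambda> \<and>
     (\<forall>W \<sigma>. lift_on S z \<Lambda> W \<sigma> \<longrightarrow>
        (\<forall>x\<in>W. \<exists>r>0. \<forall>X Y. lor (diff S z \<sigma> x X) (diff S z \<sigma> x Y) = r * (X \<bullet> Y)))"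

text \<open>
  A 1-form with values in the Lorentz algebra is a matrix-valued function \<open>\<eta> x X\<close>, linear in the
  tangent vector \<open>X\<close>. Closedness is tested on constant (hence commuting) coordinate vector fields.
\<close>

definition one_form :: "'a set \<Rightarrow> ('a \<Rightarrow> complex) \<Rightarrow>
    ('a \<Rightarrow> complex \<Rightarrow> real ^ 'i::finite ^ 'i) \<Rightarrow> bool" where
  "one_form S z \<eta> \<longleftrightarrow> (\<forall>x\<in>S. linear (\<eta> x)) \<and> (\<forall>X. smooth S z S (\<lambda>x. \<eta> x X))"

definition closed_form :: "'a set \<Rightarrow> ('a \<Rightarrow> complex) \<Rightarrow>
    ('a \<Rightarrow> complex \<Rightarrow> real ^ 'i::finite ^ 'i) \<Rightarrow> bool" where
  "closed_form S z \<eta> \<longleftrightarrow>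
     (\<forall>x\<in>S. \<forall>X Y. diff S z (\<lambda>y. \<eta> y Y) x X - diff S z (\<lambda>y. \<eta> y X) x Y = 0)"

definition isothermic_surface :: "'a::topological_space set \<Rightarrow> ('a \<Rightarrow> complex) \<Rightarrow>
    ('a \<Rightarrow> (real ^ ('m::finite option)) set) \<Rightarrow>
    ('a \<Rightarrow> complex \<Rightarrow> real ^ ('m option) ^ ('m option)) \<Rightarrow> bool" where
  "isothermic_surface S z \<Lambda> \<eta> \<longleftrightarrow>
     conformal_immersion S z \<Lambda> \<and> one_form S z \<eta> \<and> closed_form S z \<eta> \<and>
     (\<exists>x\<in>S. \<exists>X. \<eta> x X \<noteq> 0) \<and>
     (\<forall>x\<in>S. \<forall>X. \<eta> x X \<in> span {wedge u v | u v. u \<in> \<Lambda> x \<and> v \<in> orth (\<Lambda> x)})"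

section \<open>The frame and its invariants\<close>

definition normalised_lift :: "'a::topological_space set \<Rightarrow> ('a \<Rightarrow> complex) \<Rightarrow>
    ('a \<Rightarrow> (real ^ ('m::finite option)) set) \<Rightarrow> ('a \<Rightarrow> real ^ ('m option)) \<Rightarrow> bool" where
  "normalised_lift S z \<Lambda> \<psi> \<longleftrightarrow> lift_on S z \<Lambda> S \<psi> \<and>
     (\<forall>x\<in>S. \<forall>X. lor (diff S z \<psi> x X) (diff S z \<psi> x X) = (cmod X)\<^sup>2)"

abbreviation psi_z :: "'a set \<Rightarrow> ('a \<Rightarrow> complex) \<Rightarrow> ('a \<Rightarrow> real ^ 'i::finite) \<Rightarrow> 'a \<Rightarrow> complex ^ 'i" where
  "psi_z S z \<psi> \<equiv> dv_z S z (\<lambda>x. cvec (\<psi> x))"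

abbreviation psi_zbar :: "'a set \<Rightarrow> ('a \<Rightarrow> complex) \<Rightarrow> ('a \<Rightarrow> real ^ 'i::finite) \<Rightarrow> 'a \<Rightarrow> complex ^ 'i" where
  "psi_zbar S z \<psi> \<equiv> dv_zbar S z (\<lambda>x. cvec (\<psi> x))"

text \<open>The real form of the span of \<open>\<psi>\<close>, its first derivatives and its mixed second derivative.\<close>

definition central_sphere_congruence :: "'a set \<Rightarrow> ('a \<Rightarrow> complex) \<Rightarrow>
    ('a \<Rightarrow> real ^ ('m::finite option)) \<Rightarrow> 'a \<Rightarrow> (real ^ ('m option)) set" where
  "central_sphere_congruence S z \<psi> x =
     {v. cvec v \<in> vec.span {cvec (\<psi> x), psi_z S z \<psi> x, psi_zbar S z \<psi> x,
                            dv_zbar S z (psi_z S z \<psi>) x}}"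

definition dual_lift :: "'a set \<Rightarrow> ('a \<Rightarrow> complex) \<Rightarrow> ('a \<Rightarrow> real ^ ('m::finite option)) \<Rightarrow>
    ('a \<Rightarrow> real ^ ('m option)) \<Rightarrow> bool" where
  "dual_lift S z \<psi> \<psi>h \<longleftrightarrow> smooth S z S \<psi>h \<and>
     (\<forall>x\<in>S. \<psi>h x \<in> central_sphere_congruence S z \<psi> x \<and>
        lor (\<psi>h x) (\<psi>h x) = 0 \<and> lor (\<psi>h x) (\<psi> x) = -1 \<and>
        (\<forall>X. lor (\<psi>h x) (diff S z \<psi> x X) = 0))"

definition schwarzian_hopf :: "'a set \<Rightarrow> ('a \<Rightarrow> complex) \<Rightarrow> ('a \<Rightarrow> real ^ ('m::finite option)) \<Rightarrow>
    ('a \<Rightarrow> complex) \<Rightarrow> ('a \<Rightarrow> complex ^ ('m option)) \<Rightarrow> bool" where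
  "schwarzian_hopf S z \<psi> c \<kappa> \<longleftrightarrow> smooth S z S c \<and> smooth S z S \<kappa> \<and>
     (\<forall>x\<in>S. \<kappa> x \<in> complexification (orth (central_sphere_congruence S z \<psi> x)) \<and>
        dv_z S z (psi_z S z \<psi>) x + (c x / 2) *s cvec (\<psi> x) = \<kappa> x)"

definition frame_decomposition :: "'a set \<Rightarrow> ('a \<Rightarrow> complex) \<Rightarrow>
    ('a \<Rightarrow> real ^ ('m::finite option)) \<Rightarrow> ('a \<Rightarrow> real ^ ('m option)) \<Rightarrow> ('a \<Rightarrow> real ^ ('m option)) \<Rightarrow>
    ('a \<Rightarrow> real) \<Rightarrow> ('a \<Rightarrow> complex) \<Rightarrow> ('a \<Rightarrow> real) \<Rightarrow> ('a \<Rightarrow> real ^ ('m option)) \<Rightarrow> bool" where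
  "frame_decomposition S z \<psi> \<psi>h f \<alpha> \<beta> \<gamma> q \<longleftrightarrow>
     smooth S z S \<alpha> \<and> smooth S z S \<beta> \<and> smooth S z S \<gamma> \<and> smooth S z S q \<and>
     (\<forall>x\<in>S. q x \<in> orth (central_sphere_congruence S z \<psi> x) \<and>
        cvec (f x) = of_real (\<alpha> x) *s cvec (\<psi> x) + \<beta> x *s psi_z S z \<psi> x
          + cnj (\<beta> x) *s psi_zbar S z \<psi> x + of_real (\<gamma> x) *s cvec (\<psi>h x) + cvec (q x))"

section \<open>Conserved quantities\<close>

text \<open>
  Formal Laurent series and polynomials in \<open>t\<close> are both given by their families of coefficients
  indexed by the integers; \<open>dp\<^sub>i + \<eta>p\<^sub>i\<^sub>-\<^sub>1\<close> is the coefficient of \<open>t\<^sup>i\<close> in \<open>(d + t\<eta>)p(t)\<close>.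
\<close>

definition conserved :: "'a set \<Rightarrow> ('a \<Rightarrow> complex) \<Rightarrow>
    ('a \<Rightarrow> complex \<Rightarrow> real ^ 'i::finite ^ 'i) \<Rightarrow> (int \<Rightarrow> 'a \<Rightarrow> real ^ 'i) \<Rightarrow> bool" where
  "conserved S z \<eta> p \<longleftrightarrow> (\<forall>i. smooth S z S (p i)) \<and>
     (\<forall>i. \<forall>x\<in>S. \<forall>X. diff S z (p i) x X + \<eta> x X *v p (i - 1) x = 0)"

definition formal_conserved_quantity :: "'a set \<Rightarrow> ('a \<Rightarrow> complex) \<Rightarrow>
    ('a \<Rightarrow> complex \<Rightarrow> real ^ 'i::finite ^ 'i) \<Rightarrow> (int \<Rightarrow> 'a \<Rightarrow> real ^ 'i) \<Rightarrow> bool" where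
  "formal_conserved_quantity S z \<eta> p \<longleftrightarrow>
     (\<forall>i>0. \<forall>x\<in>S. p i x = 0) \<and> (\<exists>x\<in>S. p 0 x \<noteq> 0) \<and> conserved S z \<eta> p"

definition polynomial_conserved_quantity :: "'a set \<Rightarrow> ('a \<Rightarrow> complex) \<Rightarrow>
    ('a \<Rightarrow> complex \<Rightarrow> real ^ 'i::finite ^ 'i) \<Rightarrow> nat \<Rightarrow> (int \<Rightarrow> 'a \<Rightarrow> real ^ 'i) \<Rightarrow> bool" where
  "polynomial_conserved_quantity S z \<eta> d P \<longleftrightarrow>
     (\<forall>i. i < 0 \<or> i > int d \<longrightarrow> (\<forall>x\<in>S. P i x = 0)) \<and> (\<exists>x\<in>S. P (int d) x \<noteq> 0) \<and>
     conserved S z \<eta> P"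

definition special_isothermic :: "'a::topological_space set \<Rightarrow> ('a \<Rightarrow> complex) \<Rightarrow>
    ('a \<Rightarrow> (real ^ ('m::finite option)) set) \<Rightarrow>
    ('a \<Rightarrow> complex \<Rightarrow> real ^ ('m option) ^ ('m option)) \<Rightarrow> nat \<Rightarrow> bool" where
  "special_isothermic S z \<Lambda> \<eta> d \<longleftrightarrow>
     isothermic_surface S z \<Lambda> \<eta> \<and> (\<exists>P. polynomial_conserved_quantity S z \<eta> d P)"

text \<open>The hypersurface \<open>E(w)\<close> is only defined for non-zero \<open>w\<close>.\<close>

definition special_isothermic_in_E :: "'a::topological_space set \<Rightarrow> ('a \<Rightarrow> complex) \<Rightarrow>
    ('a \<Rightarrow> (real ^ ('m::finite option)) set) \<Rightarrow>
    ('a \<Rightarrow> complex \<Rightarrow> real ^ ('m option) ^ ('m option)) \<Rightarrow> nat \<Rightarrow> real ^ ('m option) \<Rightarrow> bool" where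
  "special_isothermic_in_E S z \<Lambda> \<eta> d w \<longleftrightarrow>
     isothermic_surface S z \<Lambda> \<eta> \<and> w \<noteq> 0 \<and>
     (\<exists>P. polynomial_conserved_quantity S z \<eta> d P \<and> (\<forall>x\<in>S. P 0 x \<in> span {w}))"

end

theory Submission
  imports Defs
begin

text \<open>
  Taking the coefficient of \<open>t\<^sup>i\<close> in \<open>(d + t\<eta>)p(t) = 0\<close> gives
  \<open>\<partial>\<^sub>z p\<^sub>i = (\<psi> \<and> \<psi>\<^sub>z\<^sub>b\<^sub>a\<^sub>r) p\<^sub>i\<^sub>-\<^sub>1\<close>, a combination of \<open>\<psi>\<^sub>z\<^sub>b\<^sub>a\<^sub>r\<close> and \<open>\<psi>\<close> whose \<open>\<psi>\<^sub>z\<^sub>b\<^sub>a\<^sub>r\<close>-coefficient is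
  \<open>(\<psi>, p\<^sub>i\<^sub>-\<^sub>1) = -\<gamma>\<^sub>i\<^sub>-\<^sub>1\<close>. Since \<open>\<gamma>\<^sub>i = -(p\<^sub>i, \<psi>)\<close> and this combination is orthogonal to \<open>\<psi>\<close>,
  differentiating twice yields first \<open>\<gamma>\<^sub>i\<^sub>,\<^sub>z = -(p\<^sub>i, \<psi>\<^sub>z)\<close> and then, with \<open>\<psi>\<^sub>z\<^sub>z = \<kappa> - (c/2)\<psi>\<close>,
  \<open>2\<gamma>\<^sub>i\<^sub>,\<^sub>z\<^sub>z + c\<gamma>\<^sub>i + 2(q\<^sub>i, \<kappa>) = \<gamma>\<^sub>i\<^sub>-\<^sub>1\<close>
  (\<open>schwarzian_equation_eq_next_coefficient\<close>). So the equation of the theorem says precisely that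
  \<open>\<gamma>\<^sub>-\<^sub>d\<^sub>-\<^sub>1\<close> vanishes.

  If it vanishes, differentiating \<open>(p\<^sub>-\<^sub>d\<^sub>-\<^sub>1, \<psi>) = 0\<close> shows \<open>p\<^sub>-\<^sub>d\<^sub>-\<^sub>1\<close> to be orthogonal to \<open>d\<psi>\<close> as well,
  hence \<open>\<eta>p\<^sub>-\<^sub>d\<^sub>-\<^sub>1 = 0\<close> and \<open>dp\<^sub>-\<^sub>d = 0\<close> (\<open>diff_zero_if_next_gamma_zero\<close>). The series can then be cut off
  below \<open>t\<^sup>-\<^sup>d\<close>, and multiplication by \<open>t\<^sup>d\<close> turns it into a polynomial conserved quantity of degree \<open>d\<close>
  with the constant \<open>p\<^sub>-\<^sub>d\<close> as constant term (\<open>polynomial_of_formal\<close>). Conversely, \<open>t\<^sup>-\<^sup>d P(t)\<close> is a formal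
  conserved quantity with \<open>p\<^sub>-\<^sub>d\<^sub>-\<^sub>1 = 0\<close> (\<open>formal_of_polynomial\<close>).
\<close>

section \<open>Algebra of the Lorentzian inner product\<close>

lemma lor_add_left: "lor (x + y) w = lor x w + lor y w"
  by (simp add: lor_def distrib_right sum.distrib)

lemma lor_add_right: "lor w (x + y) = lor w x + lor w y"
  by (simp add: lor_def distrib_left sum.distrib)

lemma lor_scale_left: "lor (a *s x) y = a * lor x y"
  by (simp add: lor_def sum_distrib_left right_diff_distrib mult.assoc)

lemma lor_scale_right: "lor x (a *s y) = a * lor x y"
  by (simp add: lor_def sum_distrib_left right_diff_distrib mult.left_commute)

lemma lor_minus_left: "lor (- x) y = - lor x y"
  by (simp add: lor_def sum_negf)

lemma lor_minus_right: "lor x (- y) = - lor x y"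
  by (simp add: lor_def sum_negf)

lemma lor_diff_left: "lor (x - y) w = lor x w - lor y w"
  using lor_add_left[of x "- y" w] by (simp add: lor_minus_left)

lemma lor_diff_right: "lor w (x - y) = lor w x - lor w y"
  using lor_add_right[of w x "- y"] by (simp add: lor_minus_right)

lemma lor_zero_left [simp]: "lor 0 x = 0"
  by (simp add: lor_def)

lemma lor_zero_right [simp]: "lor x 0 = 0"
  by (simp add: lor_def)

lemma lor_commute: "lor x y = lor y x"
  by (simp add: lor_def mult.commute)

lemmas lor_bilinear_simps =
  lor_add_left lor_add_right lor_diff_left lor_diff_right
  lor_minus_left lor_minus_right lor_scale_left lor_scale_right

lemma scaleR_eq_scale: "r *\<^sub>R (x :: 'k::real_algebra_1 ^ 'i) = of_real r *s x"
  by (simp add: vec_eq_iff) (simp add: scaleR_conv_of_real)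

lemma bounded_bilinear_lor:
  "bounded_bilinear (lor :: 'k::{real_normed_field,euclidean_space} ^ ('m::finite option) \<Rightarrow> _)"
  by (simp add: bilinear_conv_bounded_bilinear[symmetric] bilinear_def linear_iff
      lor_bilinear_simps scaleR_eq_scale scaleR_conv_of_real)

lemma cvec_add: "cvec (a + b) = cvec a + cvec b"
  by (simp add: cvec_def vec_eq_iff)

lemma cvec_minus: "cvec (- a) = - cvec a"
  by (simp add: cvec_def vec_eq_iff)

lemma cvec_diff: "cvec (a - b) = cvec a - cvec b"
  by (simp add: cvec_def vec_eq_iff)

lemma cvec_scale: "cvec (r *s a) = of_real r *s cvec a"
  by (simp add: cvec_def vec_eq_iff)

lemma cvec_inject: "cvec a = cvec b \<longleftrightarrow> a = b"
  by (simp add: cvec_def vec_eq_iff)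

lemmas cvec_linear_simps = cvec_add cvec_minus cvec_diff cvec_scale

lemma lor_cvec: "lor (cvec a) (cvec b) = of_real (lor a b)"
  by (simp add: lor_def cvec_def)

lemma bounded_linear_cvec: "bounded_linear (cvec :: real ^ 'i::finite \<Rightarrow> _)"
  by (simp add: linear_conv_bounded_linear[symmetric] linear_iff cvec_add scaleR_eq_scale cvec_scale)

lemma cvec_matrix_mult: "cvec (A *v w) = map_matrix of_real A *v cvec w"
  by (simp add: cvec_def vec_eq_iff matrix_vector_mult_def map_matrix_def)

lemma wedge_mult:
  fixes u v w :: "'k::field ^ ('m::finite option)"
  shows "wedge u v *v w = lor u w *s v - lor v w *s u"
proof -
  have "Vector_Spaces.linear (*s) (*s) (\<lambda>w. lor u w *s v - lor v w *s u)"
    by (unfold_locales, simp_all only: lor_bilinear_simps) (simp_all add: vec_eq_iff)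
  thus ?thesis
    unfolding wedge_def by (rule matrix_works)
qed

lemma lor_vec_span_eq_0:
  assumes "v \<in> vec.span B" "\<And>b. b \<in> B \<Longrightarrow> lor u b = 0"
  shows "lor u (v :: 'k::field ^ ('m::finite option)) = 0"
  using assms(1)
proof (induction rule: vec.span_induct_alt)
  case base
  show ?case by simp
next
  case (step a x y)
  thus ?case using assms(2) by (simp add: lor_bilinear_simps)
qed

section \<open>Smooth maps on a surface with a global coordinate\<close>

lemma Ck_cong:
  assumes "open T" "\<And>w. w \<in> T \<Longrightarrow> f w = g w" "Ck k T f"
  shows "Ck k T g"
  using assms(2,3)
proof (induction k arbitrary: f g)
  case 0
  thus ?case by (simp cong: continuous_on_cong)
next
  case (Suc k)
  have *: "(f has_derivative D) (at w) \<longleftrightarrow> (g has_derivative D) (at w)" if "w \<in> T" for w D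
    using has_derivative_transform_within_open[OF _ \<open>open T\<close> that, of f D UNIV g]
      has_derivative_transform_within_open[OF _ \<open>open T\<close> that, of g D UNIV f] Suc.prems(1) by auto
  hence "frechet_derivative f (at w) = frechet_derivative g (at w)" if "w \<in> T" for w
    using that by (simp add: frechet_derivative_def)
  moreover have "g differentiable (at w)" if "w \<in> T" for w
    using that * Suc.prems(2) by (auto simp: differentiable_def)
  moreover have "Ck k T (\<lambda>w. frechet_derivative g (at w) X)" for X
    by (rule Suc.IH[of "\<lambda>w. frechet_derivative f (at w) X"])
       (use Suc.prems calculation(1) in auto)
  ultimately show ?case
    by simp
qed

text \<open>
  For order \<open>0\<close> differentiability implies continuity; the Leibniz rule needs this because it mixes a
  factor with the derivative of the other one.
\<close>

lemma Ck_Suc_imp_Ck: "Ck (Suc k) T f \<Longrightarrow> Ck k T f"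
proof (induction k arbitrary: f)
  case 0
  thus ?case
    by (auto intro!: continuous_at_imp_continuous_on differentiable_imp_continuous_within)
next
  case (Suc k)
  thus ?case by (metis Ck.simps(2))
qed

lemma Ck_Suc_has_derivative:
  "Ck (Suc k) T f \<Longrightarrow> w \<in> T \<Longrightarrow> (f has_derivative frechet_derivative f (at w)) (at w)"
  by (simp add: frechet_derivative_works)

lemma Ck_bounded_linear:
  assumes "open T" "bounded_linear L" "Ck k T f"
  shows "Ck k T (\<lambda>w. L (f w))"
  using assms(3)
proof (induction k arbitrary: f)
  case 0
  thus ?case using bounded_linear.continuous_on[OF assms(2)] by simp
next
  case (Suc k)
  have der: "((\<lambda>w. L (f w)) has_derivative (\<lambda>X. L (frechet_derivative f (at w) X))) (at w)"
    if "w \<in> T" for w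
    by (rule bounded_linear.has_derivative[OF assms(2)
          Ck_Suc_has_derivative[OF Suc.prems that]])
  have "Ck k T (\<lambda>w. frechet_derivative (\<lambda>w. L (f w)) (at w) X)" for X
    by (rule Ck_cong[OF assms(1) _ Suc.IH[of "\<lambda>w. frechet_derivative f (at w) X"]])
       (use Suc.prems frechet_derivative_at[OF der] in \<open>auto simp: fun_eq_iff\<close>)
  thus ?case
    using der by (auto simp: differentiable_def)
qed

lemma Ck_add:
  assumes "open T" "Ck k T f" "Ck k T g"
  shows "Ck k T (\<lambda>w. f w + g w)"
  using assms(2,3)
proof (induction k arbitrary: f g)
  case 0
  thus ?case by (simp add: continuous_on_add)
next
  case (Suc k)
  have der: "((\<lambda>w. f w + g w) has_derivative
      (\<lambda>X. frechet_derivative f (at w) X + frechet_derivative g (at w) X)) (at w)"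
    if "w \<in> T" for w
    by (rule has_derivative_add[OF Ck_Suc_has_derivative[OF Suc.prems(1) that]
          Ck_Suc_has_derivative[OF Suc.prems(2) that]])
  have "Ck k T (\<lambda>w. frechet_derivative (\<lambda>w. f w + g w) (at w) X)" for X
    by (rule Ck_cong[OF assms(1) _ Suc.IH[of "\<lambda>w. frechet_derivative f (at w) X"
            "\<lambda>w. frechet_derivative g (at w) X"]])
       (use Suc.prems frechet_derivative_at[OF der] in \<open>auto simp: fun_eq_iff\<close>)
  thus ?case
    using der by (auto simp: differentiable_def)
qed

lemma Ck_bounded_bilinear:
  assumes "open T" "bounded_bilinear B" "Ck k T f" "Ck k T g"
  shows "Ck k T (\<lambda>w. B (f w) (g w))"
  using assms(3,4)
proof (induction k arbitrary: f g)
  case 0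
  thus ?case using bounded_bilinear.continuous_on[OF assms(2)] by simp
next
  case (Suc k)
  have der: "((\<lambda>w. B (f w) (g w)) has_derivative
      (\<lambda>X. B (f w) (frechet_derivative g (at w) X) + B (frechet_derivative f (at w) X) (g w))) (at w)"
    if "w \<in> T" for w
    by (rule bounded_bilinear.FDERIV[OF assms(2) Ck_Suc_has_derivative[OF Suc.prems(1) that]
          Ck_Suc_has_derivative[OF Suc.prems(2) that]])
  have Ck_k: "Ck k T f" "Ck k T g"
    using Suc.prems Ck_Suc_imp_Ck by blast+
  have "Ck k T (\<lambda>w. frechet_derivative (\<lambda>w. B (f w) (g w)) (at w) X)" for X
  proof (rule Ck_cong[OF assms(1)])
    show "Ck k T (\<lambda>w. B (f w) (frechet_derivative g (at w) X)
            + B (frechet_derivative f (at w) X) (g w))"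
      using Suc.prems Ck_k by (intro Ck_add[OF assms(1)] Suc.IH) auto
  qed (use frechet_derivative_at[OF der] in \<open>auto simp: fun_eq_iff\<close>)
  thus ?case
    using der by (auto simp: differentiable_def)
qed

lemma Ck_const: "Ck k T (\<lambda>w. a)"
  by (induction k arbitrary: a) (auto simp: frechet_derivative_const)

text \<open>
  The derivative of a map on the surface is taken in the coordinate, where the image of \<open>S\<close> is an open
  set. This makes it independent of the values outside \<open>S\<close>, and all rules of calculus carry over.
\<close>

locale coordinate_surface =
  fixes S :: "'a::topological_space set" and z :: "'a \<Rightarrow> complex"
  assumes coordinate: "riemann_surface_coordinate S z"
begin

lemma open_image: "open (z ` S)"
  using coordinate by (auto simp: riemann_surface_coordinate_def homeomorphism_def)

lemma connected_image: "connected (z ` S)"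
  using coordinate
  by (auto simp: riemann_surface_coordinate_def homeomorphism_def intro: connected_continuous_image)

lemma inv_coordinate: "x \<in> S \<Longrightarrow> inv_into S z (z x) = x"
proof -
  obtain T y where "homeomorphism S T z y"
    using coordinate unfolding riemann_surface_coordinate_def by blast
  hence "inj_on z S"
    by (intro inj_on_inverseI[of S y]) (simp add: homeomorphism_def)
  thus "x \<in> S \<Longrightarrow> inv_into S z (z x) = x"
    by (rule inv_into_f_f)
qed

lemma smooth_has_derivative:
  assumes "smooth S z S f" "x \<in> S"
  shows "((f \<circ> inv_into S z) has_derivative diff S z f x) (at (z x))"
proof -
  have "Ck (Suc 0) (z ` S) (f \<circ> inv_into S z)"
    using assms(1) unfolding smooth_def by blast
  hence "(f \<circ> inv_into S z) differentiable (at (z x))"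
    using assms(2) by auto
  moreover have "diff S z f x = frechet_derivative (f \<circ> inv_into S z) (at (z x))"
    by (simp add: diff_def fun_eq_iff)
  ultimately show ?thesis
    by (simp add: frechet_derivative_works)
qed

text \<open>The common source of the rules of calculus for \<open>diff\<close>.\<close>

lemma diff_unique:
  assumes "x \<in> S" "(g has_derivative D) (at (z x))" "\<And>y. y \<in> S \<Longrightarrow> g (z y) = f y"
  shows "diff S z f x X = D X"
proof -
  have "((f \<circ> inv_into S z) has_derivative D) (at (z x))"
    by (rule has_derivative_transform_within_open[OF assms(2) open_image])
       (use assms inv_coordinate in auto)
  thus ?thesis
    unfolding diff_def using frechet_derivative_at by metis
qed

lemma diff_cong:
  assumes "x \<in> S" "\<And>y. y \<in> S \<Longrightarrow> f y = g y" "smooth S z S g"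
  shows "diff S z f x X = diff S z g x X"
  by (rule diff_unique[OF assms(1) smooth_has_derivative[OF assms(3,1)]])
     (use assms inv_coordinate in auto)

lemma smooth_const: "smooth S z S (\<lambda>x. a)"
  by (simp add: smooth_def o_def Ck_const)

lemma diff_const: "x \<in> S \<Longrightarrow> diff S z (\<lambda>x. a) x X = 0"
  by (rule diff_unique[where g = "\<lambda>w. a" and D = "\<lambda>X. 0"]) auto

lemma smooth_diff:
  assumes "smooth S z S f"
  shows "smooth S z S (\<lambda>x. diff S z f x X)"
  unfolding smooth_def
proof
  fix k
  have "Ck (Suc k) (z ` S) (f \<circ> inv_into S z)"
    using assms unfolding smooth_def by blast
  hence *: "Ck k (z ` S) (\<lambda>w. frechet_derivative (f \<circ> inv_into S z) (at w) X)"
    by simp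
  show "Ck k (z ` S) ((\<lambda>x. diff S z f x X) \<circ> inv_into S z)"
    by (rule Ck_cong[OF open_image _ *]) (auto simp: diff_def inv_coordinate)
qed

lemma smooth_add:
  assumes "smooth S z S f" "smooth S z S g"
  shows "smooth S z S (\<lambda>x. f x + g x)"
  using assms Ck_add[OF open_image, of _ "f \<circ> inv_into S z" "g \<circ> inv_into S z"]
  by (simp add: smooth_def comp_def)

lemma smooth_linear:
  assumes "bounded_linear L" "smooth S z S f"
  shows "smooth S z S (\<lambda>x. L (f x))"
  using assms(2) Ck_bounded_linear[OF open_image assms(1), of _ "f \<circ> inv_into S z"]
  by (simp add: smooth_def comp_def)

lemma smooth_bilinear:
  assumes "bounded_bilinear B" "smooth S z S f" "smooth S z S g"
  shows "smooth S z S (\<lambda>x. B (f x) (g x))"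
  using assms(2,3)
    Ck_bounded_bilinear[OF open_image assms(1), of _ "f \<circ> inv_into S z" "g \<circ> inv_into S z"]
  by (simp add: smooth_def comp_def)

lemma diff_linear:
  assumes "bounded_linear L" "smooth S z S f" "x \<in> S"
  shows "diff S z (\<lambda>x. L (f x)) x X = L (diff S z f x X)"
  by (rule diff_unique[OF assms(3) bounded_linear.has_derivative[OF assms(1)
        smooth_has_derivative[OF assms(2,3)]]]) (simp add: inv_coordinate)

lemma diff_bilinear:
  assumes "bounded_bilinear B" "smooth S z S f" "smooth S z S g" "x \<in> S"
  shows "diff S z (\<lambda>x. B (f x) (g x)) x X = B (f x) (diff S z g x X) + B (diff S z f x X) (g x)"
  using diff_unique[OF assms(4) bounded_bilinear.FDERIV[OF assms(1)
        smooth_has_derivative[OF assms(2,4)] smooth_has_derivative[OF assms(3,4)]],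
      of "\<lambda>x. B (f x) (g x)"] assms(4)
  by (simp add: inv_coordinate)

lemma diff_is_linear: "smooth S z S f \<Longrightarrow> x \<in> S \<Longrightarrow> linear (diff S z f x)"
  using smooth_has_derivative has_derivative_linear by blast

lemma smooth_uminus: "smooth S z S f \<Longrightarrow> smooth S z S (\<lambda>x. - f x)"
  by (rule smooth_linear[OF bounded_linear_minus[OF bounded_linear_ident]])

lemma smooth_minus:
  "smooth S z S f \<Longrightarrow> smooth S z S g \<Longrightarrow> smooth S z S (\<lambda>x. f x - g x)"
  using smooth_add[of f "\<lambda>x. - g x"] smooth_uminus[of g] by simp

lemma smooth_scale:
  fixes a :: "'a \<Rightarrow> real" and f :: "'a \<Rightarrow> real ^ 'i::finite"
  assumes "smooth S z S a" "smooth S z S f"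
  shows "smooth S z S (\<lambda>x. a x *s f x)"
  using smooth_bilinear[OF bounded_bilinear_scaleR assms] by (simp add: scaleR_eq_scale)

lemma smooth_lor:
  fixes f g :: "'a \<Rightarrow> 'k::{real_normed_field,euclidean_space} ^ ('m::finite option)"
  assumes "smooth S z S f" "smooth S z S g"
  shows "smooth S z S (\<lambda>x. lor (f x) (g x))"
  using smooth_bilinear[OF bounded_bilinear_lor assms] .

lemma diff_lor:
  fixes f g :: "'a \<Rightarrow> 'k::{real_normed_field,euclidean_space} ^ ('m::finite option)"
  assumes "smooth S z S f" "smooth S z S g" "x \<in> S"
  shows "diff S z (\<lambda>x. lor (f x) (g x)) x X = lor (f x) (diff S z g x X) + lor (diff S z f x X) (g x)"
  using diff_bilinear[OF bounded_bilinear_lor assms] .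

lemma d_z_lor:
  fixes f g :: "'a \<Rightarrow> complex ^ ('m::finite option)"
  assumes "smooth S z S f" "smooth S z S g" "x \<in> S"
  shows "d_z S z (\<lambda>x. lor (f x) (g x)) x = lor (f x) (dv_z S z g x) + lor (dv_z S z f x) (g x)"
  by (simp add: d_z_def dv_z_def diff_lor[OF assms] lor_bilinear_simps algebra_simps)

lemma d_z_cong:
  assumes "x \<in> S" "\<And>y. y \<in> S \<Longrightarrow> f y = g y" "smooth S z S g"
  shows "d_z S z f x = d_z S z g x"
  by (simp add: d_z_def diff_cong[OF assms])

lemma diff_cvec:
  "smooth S z S f \<Longrightarrow> x \<in> S \<Longrightarrow> diff S z (\<lambda>x. cvec (f x)) x X = cvec (diff S z f x X)"
  by (rule diff_linear[OF bounded_linear_cvec])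

lemma dv_z_cvec:
  assumes "smooth S z S f" "x \<in> S"
  shows "dv_z S z (\<lambda>x. cvec (f x)) x
    = (1/2) *s (cvec (diff S z f x 1) - \<i> *s cvec (diff S z f x \<i>))"
  by (simp add: dv_z_def diff_cvec assms)

lemma dv_zbar_cvec:
  assumes "smooth S z S f" "x \<in> S"
  shows "dv_zbar S z (\<lambda>x. cvec (f x)) x
    = (1/2) *s (cvec (diff S z f x 1) + \<i> *s cvec (diff S z f x \<i>))"
  by (simp add: dv_zbar_def diff_cvec assms)

lemma bounded_linear_complex_scale: "bounded_linear (\<lambda>v :: complex ^ 'i::finite. a *s v)"
  by (simp add: linear_conv_bounded_linear[symmetric] linear_iff vector_add_ldistrib
      scaleR_eq_scale vector_smult_assoc mult.commute)

lemma smooth_dv_z: "smooth S z S f \<Longrightarrow> smooth S z S (dv_z S z f)"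
  unfolding dv_z_def
  by (intro smooth_linear[OF bounded_linear_complex_scale] smooth_minus smooth_diff)

lemma dv_z_uminus:
  "smooth S z S f \<Longrightarrow> x \<in> S \<Longrightarrow> dv_z S z (\<lambda>x. - f x) x = - dv_z S z f x"
  using diff_linear[OF bounded_linear_minus[OF bounded_linear_ident], of f x]
  by (simp add: dv_z_def vec_eq_iff algebra_simps)

lemma constant_if_diff_zero:
  assumes "smooth S z S f" "\<And>x X. x \<in> S \<Longrightarrow> diff S z f x X = 0"
  obtains a where "\<And>x. x \<in> S \<Longrightarrow> f x = a"
proof -
  have zero: "((f \<circ> inv_into S z) has_derivative (\<lambda>X. 0)) (at w)" if "w \<in> z ` S" for w
  proof -
    from that obtain x where x: "x \<in> S" "w = z x" by blast
    have "diff S z f x = (\<lambda>X. 0)"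
      using assms(2)[OF x(1)] by (simp add: fun_eq_iff)
    thus ?thesis
      using smooth_has_derivative[OF assms(1) x(1)] x(2) by simp
  qed
  obtain x\<^sub>0 where x\<^sub>0: "x\<^sub>0 \<in> S"
    using coordinate by (auto simp: riemann_surface_coordinate_def)
  have "f x = f x\<^sub>0" if "x \<in> S" for x
    using has_derivative_zero_unique_connected[OF open_image connected_image zero, of "z x" "z x\<^sub>0"]
      that x\<^sub>0 by (simp add: inv_coordinate)
  thus ?thesis
    using that by blast
qed

end

section \<open>The moving frame of an isothermic surface\<close>

locale isothermic_frame = coordinate_surface S z
  for S :: "'a::topological_space set" and z :: "'a \<Rightarrow> complex" +
  fixes \<Lambda> :: "'a \<Rightarrow> (real ^ ('m::finite option)) set"
    and \<eta> :: "'a \<Rightarrow> complex \<Rightarrow> real ^ ('m option) ^ ('m option)"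
    and \<psi> \<psi>h :: "'a \<Rightarrow> real ^ ('m option)"
    and c :: "'a \<Rightarrow> complex"
    and \<kappa> :: "'a \<Rightarrow> complex ^ ('m option)"
  assumes isothermic: "isothermic_surface S z \<Lambda> \<eta>"
    and lift: "normalised_lift S z \<Lambda> \<psi>"
    and eta: "\<forall>x\<in>S. \<forall>X. map_matrix of_real (\<eta> x X)
           = - wedge (cvec (\<psi> x)) (X *s psi_zbar S z \<psi> x + cnj X *s psi_z S z \<psi> x)"
    and dual: "dual_lift S z \<psi> \<psi>h"
    and hopf: "schwarzian_hopf S z \<psi> c \<kappa>"
begin

abbreviation "V \<equiv> central_sphere_congruence S z \<psi>"

lemma smooth_psi: "smooth S z S \<psi>"
  using lift by (simp add: normalised_lift_def lift_on_def)

lemma smooth_cvec_psi: "smooth S z S (\<lambda>x. cvec (\<psi> x))"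
  by (rule smooth_linear[OF bounded_linear_cvec smooth_psi])

lemma lor_psi_psi: "x \<in> S \<Longrightarrow> lor (\<psi> x) (\<psi> x) = 0"
proof -
  assume x: "x \<in> S"
  then obtain v where v: "lor v v = 0" "\<Lambda> x = span {v}"
    using isothermic
    by (auto simp: isothermic_surface_def conformal_immersion_def null_line_bundle_def)
  moreover have "\<psi> x \<in> \<Lambda> x"
    using lift x by (auto simp: normalised_lift_def lift_on_def)
  ultimately obtain a where "\<psi> x = a *\<^sub>R v"
    by (auto simp: span_singleton)
  thus ?thesis
    using v(1) by (simp add: scaleR_eq_scale lor_bilinear_simps)
qed

lemma lor_psi_dpsi:
  assumes "x \<in> S"
  shows "lor (\<psi> x) (diff S z \<psi> x X) = 0"
proof -
  have "diff S z (\<lambda>x. lor (\<psi> x) (\<psi> x)) x X = diff S z (\<lambda>x. 0) x X"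
    using assms by (intro diff_cong) (auto simp: lor_psi_psi smooth_const)
  thus ?thesis
    using assms by (simp add: diff_lor smooth_psi diff_const lor_commute)
qed

lemma lor_dpsi_psi: "x \<in> S \<Longrightarrow> lor (diff S z \<psi> x X) (\<psi> x) = 0"
  by (simp add: lor_commute[of _ "\<psi> x"] lor_psi_dpsi)

text \<open>The normalisation of the lift prescribes the quadratic form; polarisation gives the inner product.\<close>

lemma lor_dpsi_dpsi:
  assumes "x \<in> S"
  shows "lor (diff S z \<psi> x X) (diff S z \<psi> x Y) = X \<bullet> Y"
proof -
  let ?D = "diff S z \<psi> x"
  have norm: "lor (?D X) (?D X) = (cmod X)\<^sup>2" for X
    using lift assms by (simp add: normalised_lift_def)
  have "?D (X + Y) = ?D X + ?D Y"
    using diff_is_linear[OF smooth_psi assms] by (rule linear_add)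
  hence "(cmod (X + Y))\<^sup>2 = (cmod X)\<^sup>2 + 2 * lor (?D X) (?D Y) + (cmod Y)\<^sup>2"
    using norm[of "X + Y"] norm[of X] norm[of Y]
    by (simp add: lor_bilinear_simps lor_commute[of "?D Y" "?D X"])
  moreover have "(cmod (X + Y))\<^sup>2 = (cmod X)\<^sup>2 + 2 * (X \<bullet> Y) + (cmod Y)\<^sup>2"
    by (simp add: power2_norm_eq_inner inner_add_left inner_add_right inner_commute)
  ultimately show ?thesis
    by simp
qed

lemma dual_simps:
  assumes "x \<in> S"
  shows "\<psi>h x \<in> V x" "lor (\<psi>h x) (\<psi>h x) = 0" "lor (\<psi>h x) (\<psi> x) = -1"
    "lor (\<psi> x) (\<psi>h x) = -1" "lor (\<psi>h x) (diff S z \<psi> x X) = 0" "lor (diff S z \<psi> x X) (\<psi>h x) = 0"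
  using dual assms by (auto simp: dual_lift_def lor_commute)

lemma smooth_dual: "smooth S z S \<psi>h"
  using dual by (simp add: dual_lift_def)

lemmas psi_derivatives = dv_z_cvec[OF smooth_psi] dv_zbar_cvec[OF smooth_psi]

lemma frame_products:
  assumes "x \<in> S"
  shows "lor (cvec (\<psi> x)) (cvec (\<psi> x)) = 0"
    "lor (cvec (\<psi> x)) (psi_z S z \<psi> x) = 0" "lor (psi_z S z \<psi> x) (cvec (\<psi> x)) = 0"
    "lor (cvec (\<psi> x)) (psi_zbar S z \<psi> x) = 0" "lor (psi_zbar S z \<psi> x) (cvec (\<psi> x)) = 0"
    "lor (psi_z S z \<psi> x) (psi_z S z \<psi> x) = 0"
    "lor (psi_zbar S z \<psi> x) (psi_z S z \<psi> x) = 1/2"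
    "lor (cvec (\<psi>h x)) (cvec (\<psi> x)) = -1"
  using assms
  by (simp_all add: psi_derivatives lor_bilinear_simps lor_cvec lor_psi_psi lor_psi_dpsi
      lor_dpsi_psi
      lor_dpsi_dpsi dual_simps algebra_simps)

lemma dpsi_eq:
  assumes "x \<in> S"
  shows "diff S z \<psi> x X = Re X *s diff S z \<psi> x 1 + Im X *s diff S z \<psi> x \<i>"
proof -
  have "diff S z \<psi> x X = diff S z \<psi> x (Re X *\<^sub>R 1 + Im X *\<^sub>R \<i>)"
    by (rule arg_cong[of _ _ "diff S z \<psi> x"]) (simp add: complex_eq_iff)
  also have "\<dots> = Re X *s diff S z \<psi> x 1 + Im X *s diff S z \<psi> x \<i>"
    using diff_is_linear[OF smooth_psi assms]
    by (simp only: linear_add linear_scale scaleR_eq_scale of_real_eq_id id_apply)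
  finally show ?thesis .
qed

text \<open>
  The vector in the second slot of \<open>\<eta>\<close> is real: it is \<open>d\<psi>\<close> in the direction reflected at the real axis.
  This allows the action of \<open>\<eta>\<close> to be computed without complexification.
\<close>

lemma scale_dpsi:
  assumes "x \<in> S"
  shows "X *s psi_zbar S z \<psi> x + cnj X *s psi_z S z \<psi> x = cvec (diff S z \<psi> x (cnj X))"
proof -
  show ?thesis
    unfolding dpsi_eq[OF assms, of "cnj X"] psi_derivatives[OF assms]
    by (simp add: vec_eq_iff cvec_def complex_eq_iff algebra_simps add_divide_distrib diff_divide_distrib)
qed

lemma eta_mult:
  assumes "x \<in> S"
  shows "\<eta> x X *v w
    = lor (diff S z \<psi> x (cnj X)) w *s \<psi> x - lor (\<psi> x) w *s diff S z \<psi> x (cnj X)"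
proof -
  have minus: "- A *v y = - (A *v y)" for A :: "complex ^ 'm option ^ 'm option" and y
    by (simp add: vec_eq_iff matrix_vector_mult_def sum_negf)
  have "cvec (\<eta> x X *v w) = - (wedge (cvec (\<psi> x)) (cvec (diff S z \<psi> x (cnj X))) *v cvec w)"
    using eta assms by (simp add: cvec_matrix_mult scale_dpsi minus)
  also have "\<dots> = cvec (lor (diff S z \<psi> x (cnj X)) w *s \<psi> x
      - lor (\<psi> x) w *s diff S z \<psi> x (cnj X))"
    by (simp add: wedge_mult lor_cvec cvec_linear_simps)
  finally show ?thesis
    by (simp add: cvec_inject)
qed

lemma psi_in_V: "\<psi> x \<in> V x"
  by (simp add: central_sphere_congruence_def vec.span_base)

lemma dpsi_in_V:
  assumes "x \<in> S"
  shows "diff S z \<psi> x X \<in> V x"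
proof -
  have "cvec (diff S z \<psi> x X) = cnj X *s psi_zbar S z \<psi> x + X *s psi_z S z \<psi> x"
    using scale_dpsi[OF assms, of "cnj X"] by simp
  thus ?thesis
    by (simp add: central_sphere_congruence_def vec.span_add vec.span_scale vec.span_base)
qed

lemma orth_V_products:
  assumes "x \<in> S" "q \<in> orth (V x)"
  shows "lor q (\<psi> x) = 0" "lor q (diff S z \<psi> x X) = 0" "lor q (\<psi>h x) = 0"
  using assms psi_in_V dpsi_in_V dual_simps(1) by (auto simp: orth_def)

lemma kappa_products:
  assumes "x \<in> S"
  shows "lor (cvec (\<psi> x)) (\<kappa> x) = 0" "lor (psi_z S z \<psi> x) (\<kappa> x) = 0"
    "lor (psi_zbar S z \<psi> x) (\<kappa> x) = 0" "lor (cvec (\<psi>h x)) (\<kappa> x) = 0"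
proof -
  obtain a b where ab: "a \<in> orth (V x)" "b \<in> orth (V x)" "\<kappa> x = cvec a + \<i> *s cvec b"
    using hopf assms by (auto simp: schwarzian_hopf_def complexification_def)
  show "lor (cvec (\<psi> x)) (\<kappa> x) = 0" "lor (psi_z S z \<psi> x) (\<kappa> x) = 0"
    "lor (psi_zbar S z \<psi> x) (\<kappa> x) = 0" "lor (cvec (\<psi>h x)) (\<kappa> x) = 0"
    using orth_V_products[OF assms ab(1)] orth_V_products[OF assms ab(2)] assms
    by (simp_all add: ab(3) psi_derivatives lor_bilinear_simps lor_cvec lor_commute[of _ a]
        lor_commute[of _ b])
qed

text \<open>
  Orthogonality to \<open>\<psi>h\<close> can replace orthogonality to the mixed second derivative of \<open>\<psi>\<close>: the first
  three generators of \<open>V\<close> are orthogonal to \<open>\<psi>\<close> while \<open>(\<psi>h, \<psi>) = -1\<close>, so \<open>\<psi>h\<close> has a non-zero component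
  along the fourth one.
\<close>

lemma orth_V_if_orth_frame:
  assumes "x \<in> S" "lor q (\<psi> x) = 0" "\<And>X. lor q (diff S z \<psi> x X) = 0" "lor q (\<psi>h x) = 0"
  shows "q \<in> orth (V x)"
proof -
  let ?E = "{cvec (\<psi> x), psi_z S z \<psi> x, psi_zbar S z \<psi> x}"
  let ?Z = "dv_zbar S z (psi_z S z \<psi>) x"
  have E: "lor (cvec q) e = 0" if "e \<in> ?E" for e
    using that assms by (auto simp: psi_derivatives lor_bilinear_simps lor_cvec)
  have E_psi: "lor (cvec (\<psi> x)) e = 0" if "e \<in> ?E" for e
    using that frame_products[OF assms(1)] by auto
  have V: "cvec v \<in> vec.span (insert ?Z ?E)" if "v \<in> V x" for v
    using that by (simp add: central_sphere_congruence_def insert_commute)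
  (* k is the coefficient of the mixed second derivative in the dual lift *)
  obtain k where k: "cvec (\<psi>h x) - k *s ?Z \<in> vec.span ?E"
    using vec.span_breakdown_eq V[OF dual_simps(1)[OF assms(1)]] by blast
  have "k \<noteq> 0"
    using lor_vec_span_eq_0[OF k E_psi] dual_simps(4)[OF assms(1)]
    by (auto simp: lor_bilinear_simps lor_cvec)
  moreover have "k * lor (cvec q) ?Z = 0"
    using lor_vec_span_eq_0[OF k E] assms(4) by (simp add: lor_bilinear_simps lor_cvec)
  ultimately have "lor (cvec q) e = 0" if "e \<in> insert ?Z ?E" for e
    using that E by auto
  hence "lor (cvec q) (cvec v) = 0" if "v \<in> V x" for v
    using lor_vec_span_eq_0[OF V[OF that]] by blast
  thus ?thesis
    by (simp add: orth_def lor_cvec)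
qed

text \<open>
  The coefficients are forced by the inner products of the frame. In the orthonormal pair \<open>\<psi>\<^sub>u\<close>, \<open>\<psi>\<^sub>v\<close> the
  tangential part \<open>\<beta>\<psi>\<^sub>z\<close> plus its conjugate is \<open>(f, \<psi>\<^sub>u)\<psi>\<^sub>u + (f, \<psi>\<^sub>v)\<psi>\<^sub>v\<close>, which gives a real formula for
  the remainder \<open>q\<close>.
\<close>

lemma frame_decomposition_exists:
  assumes "smooth S z S f"
  obtains \<alpha> \<beta> \<gamma> q where "frame_decomposition S z \<psi> \<psi>h f \<alpha> \<beta> \<gamma> q"
proof -
  define \<alpha> where "\<alpha> = (\<lambda>x. - lor (f x) (\<psi>h x))"
  define \<gamma> where "\<gamma> = (\<lambda>x. - lor (f x) (\<psi> x))"
  define b where "b = (\<lambda>X x. lor (f x) (diff S z \<psi> x X))"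
  define \<beta> where "\<beta> = (\<lambda>x. complex_of_real (b 1 x) + \<i> * complex_of_real (b \<i> x))"
  define q where "q = (\<lambda>x. f x - \<alpha> x *s \<psi> x - b 1 x *s diff S z \<psi> x 1
      - b \<i> x *s diff S z \<psi> x \<i> - \<gamma> x *s \<psi>h x)"
  have smooth_b: "smooth S z S (b X)" for X
    unfolding b_def by (intro smooth_lor smooth_diff smooth_psi assms)
  have smooth_alpha: "smooth S z S \<alpha>" and smooth_gamma: "smooth S z S \<gamma>"
    unfolding \<alpha>_def \<gamma>_def
    by (intro smooth_uminus smooth_lor smooth_psi smooth_dual assms)+
  have smooth_beta: "smooth S z S \<beta>"
    unfolding \<beta>_def
    by (intro smooth_add smooth_linear[OF bounded_linear_of_real]
        smooth_linear[OF bounded_linear_mult_right] smooth_b)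
  have smooth_q: "smooth S z S q"
    unfolding q_def
    by (intro smooth_minus smooth_scale smooth_diff smooth_psi smooth_dual smooth_alpha smooth_gamma
        smooth_b assms)
  have q_orth: "q x \<in> orth (V x)" if x: "x \<in> S" for x
  proof (rule orth_V_if_orth_frame[OF x])
    show "lor (q x) (\<psi> x) = 0" "lor (q x) (\<psi>h x) = 0"
      using x by (simp_all add: q_def \<alpha>_def \<gamma>_def lor_bilinear_simps lor_psi_psi dual_simps
          lor_dpsi_psi)
    fix X
    show "lor (q x) (diff S z \<psi> x X) = 0"
      using x by (simp add: dpsi_eq[OF x, of X] q_def b_def lor_bilinear_simps lor_dpsi_dpsi lor_psi_dpsi dual_simps)
  qed
  have "cvec (f x) = of_real (\<alpha> x) *s cvec (\<psi> x) + \<beta> x *s psi_z S z \<psi> x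
          + cnj (\<beta> x) *s psi_zbar S z \<psi> x + of_real (\<gamma> x) *s cvec (\<psi>h x) + cvec (q x)"
    if "x \<in> S" for x
    unfolding psi_derivatives[OF that]
    by (simp add: q_def \<beta>_def cvec_def vec_eq_iff complex_eq_iff algebra_simps)
  thus ?thesis
    using that smooth_alpha smooth_beta smooth_gamma smooth_q q_orth
    unfolding frame_decomposition_def by blast
qed

lemma gamma_eq:
  assumes "frame_decomposition S z \<psi> \<psi>h f \<alpha> \<beta> \<gamma> q" "x \<in> S"
  shows "\<gamma> x = - lor (f x) (\<psi> x)"
proof -
  have "lor (cvec (q x)) (cvec (\<psi> x)) = 0"
    using assms orth_V_products(1) by (simp add: frame_decomposition_def lor_cvec)
  hence "lor (cvec (f x)) (cvec (\<psi> x)) = - of_real (\<gamma> x)"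
    using assms by (simp add: frame_decomposition_def lor_bilinear_simps frame_products)
  thus ?thesis
    by (simp add: lor_cvec flip: of_real_minus)
qed

lemma lor_kappa_eq:
  assumes "frame_decomposition S z \<psi> \<psi>h f \<alpha> \<beta> \<gamma> q" "x \<in> S"
  shows "lor (cvec (f x)) (\<kappa> x) = lor (cvec (q x)) (\<kappa> x)"
  using assms by (simp add: frame_decomposition_def lor_bilinear_simps kappa_products)

section \<open>The recursion for conserved quantities\<close>

lemma conserved_diff:
  assumes "conserved S z \<eta> p" "x \<in> S"
  shows "diff S z (p i) x X
    = lor (\<psi> x) (p (i - 1) x) *s diff S z \<psi> x (cnj X) - lor (diff S z \<psi> x (cnj X)) (p (i - 1) x) *s \<psi> x"
proof -
  have "diff S z (p i) x X = - (\<eta> x X *v p (i - 1) x)"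
    using assms by (simp add: conserved_def eq_neg_iff_add_eq_0)
  thus ?thesis
    by (simp add: eta_mult[OF assms(2)])
qed

lemma conserved_dv_z:
  assumes "conserved S z \<eta> p" "x \<in> S"
  shows "dv_z S z (\<lambda>x. cvec (p i x)) x
    = of_real (lor (\<psi> x) (p (i - 1) x)) *s psi_zbar S z \<psi> x
      - lor (psi_zbar S z \<psi> x) (cvec (p (i - 1) x)) *s cvec (\<psi> x)"
proof -
  have smooth: "smooth S z S (p i)"
    using assms(1) by (simp add: conserved_def)
  have "diff S z \<psi> x (- \<i>) = - diff S z \<psi> x \<i>"
    using diff_is_linear[OF smooth_psi assms(2)] by (rule linear_neg)
  thus ?thesis
    unfolding dv_z_cvec[OF smooth assms(2)] psi_derivatives[OF assms(2)] conserved_diff[OF assms]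
    by (simp add: cvec_linear_simps lor_bilinear_simps lor_cvec)
qed

text \<open>
  The right-hand side is \<open>\<gamma>\<^sub>i\<^sub>-\<^sub>1\<close>. It enters through \<open>(\<partial>\<^sub>z p\<^sub>i, \<psi>\<^sub>z)\<close>, because \<open>\<psi>\<^sub>z\<^sub>b\<^sub>a\<^sub>r\<close> is the only term of
  \<open>\<partial>\<^sub>z p\<^sub>i\<close> that is not orthogonal to \<open>\<psi>\<^sub>z\<close>; the Schwarzian and the Hopf differential enter through \<open>\<psi>\<^sub>z\<^sub>z\<close>.
\<close>

lemma schwarzian_equation_eq_next_coefficient:
  assumes p: "conserved S z \<eta> p"
    and frame: "frame_decomposition S z \<psi> \<psi>h (p i) \<alpha> \<beta> \<gamma> q"
    and x: "x \<in> S"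
  shows "2 * d_z S z (d_z S z (\<lambda>y. of_real (\<gamma> y))) x + c x * of_real (\<gamma> x)
      + 2 * lor (cvec (q x)) (\<kappa> x) = - of_real (lor (p (i - 1) x) (\<psi> x))"
proof -
  let ?p = "\<lambda>x. cvec (p i x)"
  have smooth_p: "smooth S z S ?p"
    using p smooth_linear[OF bounded_linear_cvec] by (auto simp: conserved_def)
  have gamma_z: "d_z S z (\<lambda>y. of_real (\<gamma> y)) y = lor (?p y) (- psi_z S z \<psi> y)" if y: "y \<in> S" for y
  proof -
    have "d_z S z (\<lambda>y. of_real (\<gamma> y)) y = d_z S z (\<lambda>y. lor (?p y) (- cvec (\<psi> y))) y"
      using y by (intro d_z_cong smooth_lor smooth_p smooth_uminus smooth_cvec_psi)
        (auto simp: gamma_eq[OF frame] lor_cvec lor_minus_right)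
    also have "\<dots> = lor (?p y) (- psi_z S z \<psi> y) + lor (dv_z S z ?p y) (- cvec (\<psi> y))"
      by (simp only: d_z_lor[OF smooth_p smooth_uminus[OF smooth_cvec_psi] y]
          dv_z_uminus[OF smooth_cvec_psi y])
    also have "lor (dv_z S z ?p y) (- cvec (\<psi> y)) = 0"
      using y by (simp add: conserved_dv_z[OF p] lor_bilinear_simps frame_products)
    finally show ?thesis
      by simp
  qed
  have "d_z S z (d_z S z (\<lambda>y. of_real (\<gamma> y))) x = d_z S z (\<lambda>y. lor (?p y) (- psi_z S z \<psi> y)) x"
    by (intro d_z_cong x gamma_z smooth_lor smooth_p smooth_uminus smooth_dv_z smooth_cvec_psi)
  also have "\<dots> = lor (?p x) (- dv_z S z (psi_z S z \<psi>) x)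
      + lor (dv_z S z ?p x) (- psi_z S z \<psi> x)"
    by (simp only: d_z_lor[OF smooth_p smooth_uminus[OF smooth_dv_z[OF smooth_cvec_psi]] x]
        dv_z_uminus[OF smooth_dv_z[OF smooth_cvec_psi] x])
  also have "lor (dv_z S z ?p x) (- psi_z S z \<psi> x) = - of_real (lor (\<psi> x) (p (i - 1) x)) / 2"
    using x by (simp add: conserved_dv_z[OF p] lor_bilinear_simps frame_products)
  also have "dv_z S z (psi_z S z \<psi>) x = \<kappa> x - (c x / 2) *s cvec (\<psi> x)"
    using hopf x by (simp add: schwarzian_hopf_def eq_diff_eq)
  finally show ?thesis
    using lor_kappa_eq[OF frame x] gamma_eq[OF frame x]
    by (simp add: lor_bilinear_simps lor_cvec lor_commute[of "\<psi> x" "p (i - 1) x"] algebra_simps)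
qed

text \<open>
  The derivative of \<open>p\<^sub>i\<^sub>-\<^sub>1\<close> lies in the span of \<open>\<psi>\<close> and \<open>d\<psi>\<close>, hence is orthogonal to \<open>\<psi>\<close>. Differentiating
  \<open>(p\<^sub>i\<^sub>-\<^sub>1, \<psi>) = 0\<close> therefore makes \<open>p\<^sub>i\<^sub>-\<^sub>1\<close> orthogonal to \<open>d\<psi>\<close>, so that \<open>\<eta>\<close> annihilates it.
\<close>

lemma diff_zero_if_next_gamma_zero:
  assumes p: "conserved S z \<eta> p" and zero: "\<And>x. x \<in> S \<Longrightarrow> lor (p (i - 1) x) (\<psi> x) = 0"
    and x: "x \<in> S"
  shows "diff S z (p i) x X = 0"
proof -
  have smooth: "smooth S z S (p (i - 1))"
    using p by (simp add: conserved_def)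
  have "diff S z (\<lambda>x. lor (p (i - 1) x) (\<psi> x)) x Y = diff S z (\<lambda>x. 0) x Y" for Y
    by (intro diff_cong x zero smooth_const)
  hence "lor (p (i - 1) x) (diff S z \<psi> x Y) = 0" for Y
    using x by (simp add: diff_lor smooth smooth_psi diff_const conserved_diff[OF p]
        lor_bilinear_simps lor_psi_psi lor_dpsi_psi)
  thus ?thesis
    using zero[OF x] by (simp add: conserved_diff[OF p x] lor_commute[of _ "p (i - 1) x"])
qed

text \<open>
  Constancy of \<open>p\<^sub>-\<^sub>d\<close> is what the truncated series needs in its lowest order, where the term with \<open>\<eta>\<close>
  has been cut off.
\<close>

lemma polynomial_of_formal:
  assumes p: "formal_conserved_quantity S z \<eta> p"
    and const: "\<And>x X. x \<in> S \<Longrightarrow> diff S z (p (- int d)) x X = 0"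
  shows "polynomial_conserved_quantity S z \<eta> d
    (\<lambda>i. if i < 0 then \<lambda>x. 0 else p (i - int d))"
proof -
  define P where "P = (\<lambda>i. if i < 0 then \<lambda>x. 0 else p (i - int d))"
  have "smooth S z S (P i)" for i
    using p smooth_const by (auto simp: P_def formal_conserved_quantity_def conserved_def)
  moreover have "diff S z (P i) x X + \<eta> x X *v P (i - 1) x = 0" if "x \<in> S" for i x X
  proof -
    consider "i < 0" | "i = 0" | "i > 0" by linarith
    thus ?thesis
    proof cases
      case 1
      thus ?thesis using that by (simp add: P_def diff_const)
    next
      case 2
      thus ?thesis using const[OF that] by (simp add: P_def)
    next
      case 3
      have "diff S z (p (i - int d)) x X + \<eta> x X *v p (i - int d - 1) x = 0"
        using p that unfolding formal_conserved_quantity_def conserved_def by blast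
      moreover have "i - 1 - int d = i - int d - 1"
        by simp
      ultimately show ?thesis
        using 3 by (simp only: P_def) simp
    qed
  qed
  ultimately have "polynomial_conserved_quantity S z \<eta> d P"
    using p unfolding polynomial_conserved_quantity_def formal_conserved_quantity_def conserved_def
    by (auto simp: P_def)
  thus ?thesis
    unfolding P_def .
qed

lemma formal_of_polynomial:
  assumes "polynomial_conserved_quantity S z \<eta> d P"
  shows "formal_conserved_quantity S z \<eta> (\<lambda>i. P (i + int d))"
proof -
  have shift: "i - 1 + int d = i + int d - 1" for i
    by simp
  show ?thesis
    using assms unfolding polynomial_conserved_quantity_def formal_conserved_quantity_def conserved_def
    by (simp add: shift)
qed

end

theorem theorem3p1:
  fixes S :: "'a::topological_space set"
    and z :: "'a \<Rightarrow> complex"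
    and \<Lambda> :: "'a \<Rightarrow> (real ^ ('m::finite option)) set"
    and \<eta> :: "'a \<Rightarrow> complex \<Rightarrow> real ^ ('m option) ^ ('m option)"
    and \<psi> \<psi>h :: "'a \<Rightarrow> real ^ ('m option)"
    and c :: "'a \<Rightarrow> complex"
    and \<kappa> :: "'a \<Rightarrow> complex ^ ('m option)"
    and d :: nat
  assumes "riemann_surface_coordinate S z"
    and "isothermic_surface S z \<Lambda> \<eta>"
    and "normalised_lift S z \<Lambda> \<psi>"
    and "\<forall>x\<in>S. \<forall>X. map_matrix of_real (\<eta> x X)
           = - wedge (cvec (\<psi> x)) (X *s psi_zbar S z \<psi> x + cnj X *s psi_z S z \<psi> x)"
    and "dual_lift S z \<psi> \<psi>h"
    and "schwarzian_hopf S z \<psi> c \<kappa>"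
  shows "(special_isothermic S z \<Lambda> \<eta> d \<longleftrightarrow>
           (\<exists>p \<alpha> \<beta> \<gamma> q. formal_conserved_quantity S z \<eta> p \<and>
              frame_decomposition S z \<psi> \<psi>h (p (- int d)) \<alpha> \<beta> \<gamma> q \<and>
              (\<forall>x\<in>S. 2 * d_z S z (d_z S z (\<lambda>y. of_real (\<gamma> y))) x + c x * of_real (\<gamma> x)
                 + 2 * lor (cvec (q x)) (\<kappa> x) = 0)))
       \<and> (\<forall>p \<alpha> \<beta> \<gamma> q. formal_conserved_quantity S z \<eta> p \<and>
              frame_decomposition S z \<psi> \<psi>h (p (- int d)) \<alpha> \<beta> \<gamma> q \<and>
              (\<forall>x\<in>S. 2 * d_z S z (d_z S z (\<lambda>y. of_real (\<gamma> y))) x + c x * of_real (\<gamma> x)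
                 + 2 * lor (cvec (q x)) (\<kappa> x) = 0) \<and>
              (\<exists>x\<in>S. \<gamma> x \<noteq> 0)
            \<longrightarrow> (\<exists>w. (\<forall>x\<in>S. p (- int d) x = w) \<and> special_isothermic_in_E S z \<Lambda> \<eta> d w))"
proof -
  interpret isothermic_frame S z \<Lambda> \<eta> \<psi> \<psi>h c \<kappa>
    using assms by (intro isothermic_frame.intro coordinate_surface.intro isothermic_frame_axioms.intro)
  let ?equation = "\<lambda>\<gamma> q. \<forall>x\<in>S. 2 * d_z S z (d_z S z (\<lambda>y. of_real (\<gamma> y))) x
      + c x * of_real (\<gamma> x) + 2 * lor (cvec (q x)) (\<kappa> x) = 0"
  have diff_zero: "diff S z (p (- int d)) x X = 0"
    if p: "formal_conserved_quantity S z \<eta> p"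
      and frame: "frame_decomposition S z \<psi> \<psi>h (p (- int d)) \<alpha> \<beta> \<gamma> q"
      and eq: "?equation \<gamma> q" and x: "x \<in> S" for p \<alpha> \<beta> \<gamma> q x X
  proof (rule diff_zero_if_next_gamma_zero[OF _ _ x])
    show cons: "conserved S z \<eta> p"
      using p by (simp add: formal_conserved_quantity_def)
    show "lor (p (- int d - 1) y) (\<psi> y) = 0" if "y \<in> S" for y
      using schwarzian_equation_eq_next_coefficient[OF cons frame that] eq that by simp
  qed
  show ?thesis
  proof (intro conjI iffI allI impI)
    assume "special_isothermic S z \<Lambda> \<eta> d"
    then obtain P where P: "polynomial_conserved_quantity S z \<eta> d P"
      by (auto simp: special_isothermic_def)
    define p where "p = (\<lambda>i. P (i + int d))"
    have p: "formal_conserved_quantity S z \<eta> p"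
      unfolding p_def by (rule formal_of_polynomial[OF P])
    hence cons: "conserved S z \<eta> p"
      by (simp add: formal_conserved_quantity_def)
    hence "smooth S z S (p (- int d))"
      by (simp add: conserved_def)
    then obtain \<alpha> \<beta> \<gamma> q where frame: "frame_decomposition S z \<psi> \<psi>h (p (- int d)) \<alpha> \<beta> \<gamma> q"
      by (rule frame_decomposition_exists)
    have "p (- int d - 1) x = 0" if "x \<in> S" for x
      using P that by (simp add: p_def polynomial_conserved_quantity_def)
    hence "?equation \<gamma> q"
      using schwarzian_equation_eq_next_coefficient[OF cons frame] by simp
    thus "\<exists>p \<alpha> \<beta> \<gamma> q. formal_conserved_quantity S z \<eta> p \<and>
        frame_decomposition S z \<psi> \<psi>h (p (- int d)) \<alpha> \<beta> \<gamma> q \<and> ?equation \<gamma> q"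
      using p frame by blast
  next
    assume "\<exists>p \<alpha> \<beta> \<gamma> q. formal_conserved_quantity S z \<eta> p \<and>
        frame_decomposition S z \<psi> \<psi>h (p (- int d)) \<alpha> \<beta> \<gamma> q \<and> ?equation \<gamma> q"
    then obtain p \<alpha> \<beta> \<gamma> q where p: "formal_conserved_quantity S z \<eta> p"
      "frame_decomposition S z \<psi> \<psi>h (p (- int d)) \<alpha> \<beta> \<gamma> q" "?equation \<gamma> q"
      by blast
    show "special_isothermic S z \<Lambda> \<eta> d"
      unfolding special_isothermic_def
      using isothermic polynomial_of_formal[OF p(1) diff_zero[OF p]] by blast
  next
    fix p \<alpha> \<beta> \<gamma> q
    assume "formal_conserved_quantity S z \<eta> p \<and>
        frame_decomposition S z \<psi> \<psi>h (p (- int d)) \<alpha> \<beta> \<gamma> q \<and> ?equation \<gamma> q \<and> (\<exists>x\<in>S. \<gamma> x \<noteq> 0)"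
    then obtain x where p: "formal_conserved_quantity S z \<eta> p"
      "frame_decomposition S z \<psi> \<psi>h (p (- int d)) \<alpha> \<beta> \<gamma> q" "?equation \<gamma> q"
      and x: "x \<in> S" "\<gamma> x \<noteq> 0"
      by blast
    have smooth: "smooth S z S (p (- int d))"
      using p(1) by (simp add: formal_conserved_quantity_def conserved_def)
    obtain w where w: "\<And>x. x \<in> S \<Longrightarrow> p (- int d) x = w"
      using constant_if_diff_zero[OF smooth diff_zero[OF p]] by blast
    have "w \<noteq> 0"
      using gamma_eq[OF p(2) x(1)] x w by auto
    hence "special_isothermic_in_E S z \<Lambda> \<eta> d w"
      unfolding special_isothermic_in_E_def
      using isothermic polynomial_of_formal[OF p(1) diff_zero[OF p]] w span_base[of w "{w}"]
      by fastforce
    thus "\<exists>w. (\<forall>x\<in>S. p (- int d) x = w) \<and> special_isothermic_in_E S z \<Lambda> \<eta> d w"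
      using w by blast
  qed
qed

end
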